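(* Every function $f:\{0,1\}^n\to\mathbb{C}$ has an expansion $$f(x_1,\dots,x_n)=a_0+\sum_{i}a_i x_i+\sum_{i<j}a_{ij}x_ix_j+\cdots+a_{12\cdots n}x_1x_2\cdots x_n$$ with complex coefficients (one coefficient $a_T$ for each subset $T\subseteq\{1,\dots,n\}$), and this expansion is canonical, i.e. for a fixed labeling of the variables the coefficients are uniquely determined by $f$.
   Context: An expansion is called canonical when it is unique up to labeling of the variables. *)

theory Defs
  imports Complex_Main "HOL-Library.FuncSet"
begin

definition cube :: "nat \<Rightarrow> (nat \<Rightarrow> nat) set" where
  "cube n = {1..n} \<rightarrow>\<^sub>E {0, 1}"

text \<open>The coefficient of the empty set is the constant term \<open>a\<^sub>0\<close>; only the values of \<open>f\<close> on
  \<open>cube n\<close> and those of \<open>a\<close> on subsets of \<open>{1..n}\<close> matter.\<close>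

definition is_expansion :: "nat \<Rightarrow> ((nat \<Rightarrow> nat) \<Rightarrow> complex) \<Rightarrow> (nat set \<Rightarrow> complex) \<Rightarrow> bool" where
  "is_expansion n f a \<longleftrightarrow>
     (\<forall>x\<in>cube n. f x = (\<Sum>T\<in>Pow {1..n}. a T * (\<Prod>i\<in>T. of_nat (x i))))"

end

theory Submission
  imports Defs
begin

text \<open>Points of the cube are indicator functions of subsets \<open>S\<close>, and the monomial of \<open>T\<close> takes the
  value \<open>1\<close> at \<open>S\<close> if \<open>T \<subseteq> S\<close> and \<open>0\<close> otherwise. So an expansion of \<open>f\<close> is a solution \<open>a\<close> of
  \<open>f S = (\<Sum>T\<subseteq>S. a T)\<close>, a system that is unitriangular with respect to inclusion and solved by
  Moebius inversion.\<close>

text \<open>The restricted lambda makes the point \<open>undefined\<close> off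
  \<open>{1..n}\<close>, as the extensional space \<open>cube n\<close> demands.\<close>

definition ind_point :: "nat \<Rightarrow> nat set \<Rightarrow> nat \<Rightarrow> nat" where
  "ind_point n S = (\<lambda>i\<in>{1..n}. if i \<in> S then 1 else 0)"

lemma cube_eq_image_ind_point: "cube n = ind_point n ` Pow {1..n}"
proof
  show "cube n \<subseteq> ind_point n ` Pow {1..n}"
  proof
    fix x assume x: "x \<in> cube n"
    \<comment> \<open>The preimage is the support of \<open>x\<close>; off \<open>{1..n}\<close>
      both sides are \<open>undefined\<close>.\<close>
    have "x i = ind_point n {i\<in>{1..n}. x i = 1} i" for i
      using x by (cases "i \<in> {1..n}") (auto simp: cube_def ind_point_def PiE_iff extensional_def)
    then have "x = ind_point n {i\<in>{1..n}. x i = 1}" ..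
    then show "x \<in> ind_point n ` Pow {1..n}" by blast
  qed
  show "ind_point n ` Pow {1..n} \<subseteq> cube n"
    by (auto simp: cube_def ind_point_def split: if_splits)
qed

lemma monomial_ind_point:
  assumes "T \<subseteq> {1..n}"
  shows "(\<Prod>i\<in>T. of_nat (ind_point n S i)) = (if T \<subseteq> S then 1 else 0 :: 'a::comm_semiring_1)"
proof (cases "T \<subseteq> S")
  case True
  then have "(\<Prod>i\<in>T. of_nat (ind_point n S i)) = (\<Prod>i\<in>T. 1 :: 'a)"
    using assms by (intro prod.cong) (auto simp: ind_point_def)
  with True show ?thesis by simp
next
  case False
  then obtain i where i: "i \<in> T" "i \<notin> S" by blast
  have "finite T" using assms finite_subset by blast
  \<comment> \<open>Since \<open>T \<subseteq> {1..n}\<close>, the value at \<open>i\<close> is a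
    true 0, not \<open>undefined\<close>, and this factor kills the product.\<close>
  moreover have "of_nat (ind_point n S i) = (0 :: 'a)"
    using i assms by (auto simp: ind_point_def)
  ultimately have "(\<Prod>i\<in>T. of_nat (ind_point n S i)) = (0 :: 'a)"
    using i(1) by (metis prod.remove mult_zero_left)
  with False show ?thesis by simp
qed

lemma is_expansion_iff_subset_sums:
  "is_expansion n f a \<longleftrightarrow> (\<forall>S\<in>Pow {1..n}. f (ind_point n S) = sum a (Pow S))"
proof -
  have "(\<Sum>T\<in>Pow {1..n}. a T * (\<Prod>i\<in>T. of_nat (ind_point n S i))) = sum a (Pow S)"
    if "S \<subseteq> {1..n}" for S
  proof -
    have "(\<Sum>T\<in>Pow {1..n}. a T * (\<Prod>i\<in>T. of_nat (ind_point n S i)))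
        = (\<Sum>T\<in>Pow {1..n}. if T \<in> Pow S then a T else 0)"
      by (intro sum.cong refl) (simp add: monomial_ind_point)
    also have "\<dots> = sum a (Pow {1..n} \<inter> Pow S)"
      by (simp add: sum.inter_restrict)
    also have "Pow {1..n} \<inter> Pow S = Pow S"
      using that by blast
    finally show ?thesis .
  qed
  then show ?thesis
    by (simp add: is_expansion_def cube_eq_image_ind_point)
qed

lemma subset_sums_solvable:
  fixes g :: "'a set \<Rightarrow> 'b::ring_1"
  obtains a where "\<And>S. finite S \<Longrightarrow> g S = sum a (Pow S)"
proof -
  \<comment> \<open>The signed subset-sum transform is an involution on finite sets. Applying it
    twice to \<open>g\<close> exhibits the solution \<open>(-1) ^ card T * h T\<close>, which for
    finite \<open>T\<close> is the Moebius inverse of \<open>g\<close>.\<close>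
  define h where "h S = (\<Sum>T\<in>Pow S. (-1) ^ card T * g T)" for S
  have "g S = (\<Sum>T\<in>Pow S. (-1) ^ card T * h T)" if "finite S" for S
    using that by (intro inclusion_exclusion_symmetric[of h g]) (simp_all add: h_def)
  then show thesis by (rule that)
qed

lemma subset_sums_determine:
  fixes a b :: "'a set \<Rightarrow> 'b::ab_group_add"
  assumes "finite A" and eq: "\<And>S. S \<subseteq> A \<Longrightarrow> sum a (Pow S) = sum b (Pow S)" and "S \<subseteq> A"
  shows "a S = b S"
proof -
  have "finite S" using assms finite_subset by blast
  then show ?thesis using \<open>S \<subseteq> A\<close>
  proof (induction S rule: finite_psubset_induct)
    case (psubset S)
    \<comment> \<open>By induction \<open>a\<close> and \<open>b\<close> agree on proper subsets of
      \<open>S\<close>, so the equation at \<open>S\<close> leaves only the top terms to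
      compare.\<close>
    have "sum a (Pow S - {S}) = sum b (Pow S - {S})"
      using psubset by (intro sum.cong) auto
    moreover have "sum c (Pow S) = c S + sum c (Pow S - {S})" for c :: "'a set \<Rightarrow> 'b"
      using psubset.hyps by (intro sum.remove) auto
    ultimately show ?case
      using eq[OF psubset.prems] by simp
  qed
qed

theorem proposition2:
  fixes n :: nat and f :: "(nat \<Rightarrow> nat) \<Rightarrow> complex"
  shows "\<exists>!a. a \<in> Pow {1..n} \<rightarrow>\<^sub>E (UNIV :: complex set) \<and> is_expansion n f a"
proof (rule ex_ex1I)
  obtain a where a: "\<And>S. finite S \<Longrightarrow> f (ind_point n S) = sum a (Pow S)"
    by (rule subset_sums_solvable[of "\<lambda>S. f (ind_point n S)"]) (rule that)
  \<comment> \<open>The solution found lives on all finite sets. Cutting it down to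
    \<open>Pow {1..n}\<close> puts it in the extensional space and keeps the sums, as subsets of
    \<open>S\<close> stay inside \<open>{1..n}\<close>.\<close>
  have "f (ind_point n S) = sum (restrict a (Pow {1..n})) (Pow S)" if "S \<subseteq> {1..n}" for S
  proof -
    have "sum (restrict a (Pow {1..n})) (Pow S) = sum a (Pow S)"
      using that by (intro sum.cong) auto
    moreover have "finite S"
      using that by (rule finite_subset) simp
    ultimately show ?thesis by (simp add: a)
  qed
  then have "is_expansion n f (restrict a (Pow {1..n}))"
    by (simp add: is_expansion_iff_subset_sums)
  then show "\<exists>a. a \<in> Pow {1..n} \<rightarrow>\<^sub>E (UNIV :: complex set) \<and> is_expansion n f a"
    by (intro exI[of _ "restrict a (Pow {1..n})"] conjI) auto
next
  fix a b
  assume a: "a \<in> Pow {1..n} \<rightarrow>\<^sub>E (UNIV :: complex set) \<and> is_expansion n f a"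
    and b: "b \<in> Pow {1..n} \<rightarrow>\<^sub>E (UNIV :: complex set) \<and> is_expansion n f b"
  have "a S = b S" if "S \<in> Pow {1..n}" for S
  proof (rule subset_sums_determine)
    show "sum a (Pow R) = sum b (Pow R)" if "R \<subseteq> {1..n}" for R
      using a b that by (simp add: is_expansion_iff_subset_sums)
  qed (use that in auto)
  \<comment> \<open>Off \<open>Pow {1..n}\<close> both functions are \<open>undefined\<close> by
    extensionality.\<close>
  with a b show "a = b"
    by (intro PiE_ext[of a "Pow {1..n}" "\<lambda>_. UNIV" b]) auto
qed

end
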